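(* Let $\sigma>\frac12$. The characteristic function $\psi_\sigma$ of the random variable $\Im S$ (defined in the context) extends to an entire function of $x$, given for all $x\in\mathbb{C}$ by the convergent infinite product over the primes \[ \psi_\sigma(2x)=\prod_p\Bigl(1+\sum_{n=1}^\infty\frac{1}{n!^2}\prod_{j=0}^{n-1}(j^2-x^2)\cdot \frac{1}{p^{2n\sigma}}\Bigr). \]
   Context: Let $P$ be the set of primes and let $(z_p)_{p\in P}$ be independent random variables, each uniformly distributed on the unit circle $\{z\in\mathbb{C}:|z|=1\}$ (i.e. the coordinate functions on $\Omega=\mathbb{T}^P$ with the product of normalized arc-length measures). For $\sigma>\frac12$ let \[S:=-\sum_{p\in P}\log(1-p^{-\sigma}z_p)=\sum_{p\in P}\sum_{k=1}^\infty\frac1k p^{-k\sigma}z_p^k,\] with the principal logarithm; this series converges almost surely. Note $\Im S=-\sum_p\arg(1-p^{-\sigma}z_p)$ with $\arg$ the principal argument. The characteristic function of $\Im S$ is $\psi_\sigma(x):=\mathbb{E}[\exp(ix\,\Im S)]$ for $x\in\mathbb{R}$. *)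

theory Defs
  imports "HOL-Probability.Probability" "HOL-Complex_Analysis.Complex_Analysis"
begin

definition uniform_circle :: "complex measure" where
  "uniform_circle = distr (uniform_measure lborel {0..<2 * pi}) borel cis"

text \<open>
  The sum over the primes is taken in increasing order: for \<open>\<sigma> \<le> 1\<close> it converges
  almost surely but not absolutely. On the null set where it diverges the value is immaterial.
\<close>
definition prime_log_sum :: "(nat \<Rightarrow> 'a \<Rightarrow> complex) \<Rightarrow> real \<Rightarrow> 'a \<Rightarrow> complex" where
  "prime_log_sum z \<sigma> \<omega> =
     - (\<Sum>p. if prime p then Ln (1 - of_real (real p powr (- \<sigma>)) * z p \<omega>) else 0)"

definition psi :: "'a measure \<Rightarrow> (nat \<Rightarrow> 'a \<Rightarrow> complex) \<Rightarrow> real \<Rightarrow> real \<Rightarrow> complex" where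
  "psi M z \<sigma> = char (distr M borel (\<lambda>\<omega>. Im (prime_log_sum z \<sigma> \<omega>)))"

definition factor_term :: "real \<Rightarrow> nat \<Rightarrow> complex \<Rightarrow> nat \<Rightarrow> complex" where
  "factor_term \<sigma> p x n =
     1 / (fact n)\<^sup>2 * (\<Prod>j<n. (of_nat j)\<^sup>2 - x\<^sup>2) * of_real (1 / real p powr (2 * real n * \<sigma>))"

definition euler_factor :: "real \<Rightarrow> nat \<Rightarrow> complex \<Rightarrow> complex" where
  "euler_factor \<sigma> p x = 1 + (\<Sum>n. factor_term \<sigma> p x (Suc n))"

lemma prob_space_uniform_circle: "prob_space uniform_circle"
proof -
  have "prob_space (uniform_measure lborel {0..<2 * pi})"
    by (rule prob_space_uniform_measure) auto
  then show ?thesis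
    unfolding uniform_circle_def
    by (rule prob_space.prob_space_distr)
       (simp add: measurable_cong_sets[OF sets_uniform_measure refl]
          borel_measurable_continuous_onI continuous_intros)
qed

text \<open>
  The coordinate functions on the product of copies of the circle, indexed by the primes, are
  independent and uniformly distributed on the circle.
\<close>
lemma coordinates_indep_uniform_circle:
  defines "\<Omega> \<equiv> PiM {p::nat. prime p} (\<lambda>_. uniform_circle)"
  shows "prob_space \<Omega>"
    and "prob_space.indep_vars \<Omega> (\<lambda>_. borel) (\<lambda>p \<omega>. \<omega> p) {p. prime p}"
    and "prime p \<Longrightarrow> distr \<Omega> borel (\<lambda>\<omega>. \<omega> p) = uniform_circle"
proof -
  have sets: "sets uniform_circle = sets borel"
    by (simp add: uniform_circle_def)
  show ps: "prob_space \<Omega>"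
    unfolding \<Omega>_def by (rule prob_space_PiM) (rule prob_space_uniform_circle)
  show d: "distr \<Omega> borel (\<lambda>\<omega>. \<omega> p) = uniform_circle" if "prime p" for p
  proof -
    have "distr \<Omega> uniform_circle (\<lambda>\<omega>. \<omega> p) = uniform_circle"
      unfolding \<Omega>_def using that
      by (intro distr_PiM_component prob_space_uniform_circle) auto
    then show ?thesis using distr_cong[OF refl sets, of \<Omega> "\<lambda>\<omega>. \<omega> p" "\<lambda>\<omega>. \<omega> p"] by simp
  qed
  have ne: "{p::nat. prime p} \<noteq> {}" using two_is_prime_nat by blast
  have sets_\<Omega>: "sets \<Omega> = sets (PiM {p. prime p} (\<lambda>_. borel))"
    unfolding \<Omega>_def by (rule sets_PiM_cong) (simp_all add: sets)
  have rv: "(\<lambda>\<omega>. \<omega> p) \<in> \<Omega> \<rightarrow>\<^sub>M borel" if "p \<in> {p. prime p}" for p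
    unfolding measurable_cong_sets[OF sets_\<Omega> refl]
    using that by (rule measurable_component_singleton)
  have "distr \<Omega> (PiM {p. prime p} (\<lambda>_. borel)) (\<lambda>\<omega>. restrict \<omega> {p. prime p}) = distr \<Omega> \<Omega> id"
    by (rule distr_cong) (auto simp: sets_\<Omega>, auto simp: \<Omega>_def space_PiM PiE_restrict)
  also have "\<dots> = PiM {p. prime p} (\<lambda>p. distr \<Omega> borel (\<lambda>\<omega>. \<omega> p))"
    unfolding id_def distr_id unfolding \<Omega>_def
    by (rule PiM_cong) (simp_all add: d[unfolded \<Omega>_def])
  finally show "prob_space.indep_vars \<Omega> (\<lambda>_. borel) (\<lambda>p \<omega>. \<omega> p) {p. prime p}"
    using prob_space.indep_vars_iff_distr_eq_PiM'[OF ps ne rv] by (simp add: restrict_def)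
qed

end

theory Submission
  imports Defs
begin

text \<open>
  Write \<open>r = p\<^bsup>-\<sigma>\<^esup>\<close>. On the unit circle \<open>exp (2 i x Im (- Ln (1 - r w))) = (1 - r w)\<^bsup>-x\<^esup> (1 - r cnj w)\<^bsup>x\<^esup>\<close>;
  expanding both powers binomially, only the diagonal terms have nonzero mean, and these are the
  terms of the factor at \<open>p\<close>. The numbers \<open>Ln (1 - r z\<^sub>p)\<close> are independent, of mean zero and with
  second moments \<open>O(p\<^bsup>-2\<sigma>\<^esup>)\<close>, so the series converges almost surely by Kolmogorov's theorem, and by
  dominated convergence the characteristic function is the product of the factors for real \<open>x\<close>. The
  factors differ from 1 by \<open>O(p\<^bsup>-2\<sigma>\<^esup>)\<close> locally uniformly in \<open>x\<close>, so the product is entire.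
\<close>

section \<open>Kolmogorov's one-series theorem\<close>

text \<open>Domination by \<open>f^2 + g^2\<close>. With \<open>g\<close> the constant 1 it turns
  square integrability into integrability on a probability space.\<close>

lemma integrable_mult_of_square:
  fixes f g :: "'a \<Rightarrow> real"
  assumes [measurable]: "f \<in> borel_measurable M" "g \<in> borel_measurable M"
    and "integrable M (\<lambda>\<omega>. (f \<omega>)\<^sup>2)" "integrable M (\<lambda>\<omega>. (g \<omega>)\<^sup>2)"
  shows "integrable M (\<lambda>\<omega>. f \<omega> * g \<omega>)"
proof (rule Bochner_Integration.integrable_bound)
  show "integrable M (\<lambda>\<omega>. (f \<omega>)\<^sup>2 + (g \<omega>)\<^sup>2)" using assms by simp
  have "\<bar>a * b\<bar> \<le> a\<^sup>2 + b\<^sup>2" for a b :: real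
  proof -
    have "2 * (\<bar>a\<bar> * \<bar>b\<bar>) \<le> a\<^sup>2 + b\<^sup>2" using sum_squares_bound[of "\<bar>a\<bar>" "\<bar>b\<bar>"] by simp
    moreover have "0 \<le> \<bar>a\<bar> * \<bar>b\<bar>" by simp
    ultimately show ?thesis unfolding abs_mult by linarith
  qed
  then show "AE \<omega> in M. norm (f \<omega> * g \<omega>) \<le> norm ((f \<omega>)\<^sup>2 + (g \<omega>)\<^sup>2)" by simp
qed measurable

context prob_space
begin

text \<open>
  The partial sums are stopped at the first time \<open>i\<close> with \<open>\<bar>S\<^sub>i\<bar> \<ge> \<epsilon>\<close>; the increments of the
  stopped sum are orthogonal, so its second moment is at most that of the full sum.
\<close>
theorem kolmogorov_maximal_inequality:
  fixes X :: "nat \<Rightarrow> 'a \<Rightarrow> real"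
  assumes ind: "indep_vars (\<lambda>_. borel) X A"
    and sq: "\<And>i. i \<in> A \<Longrightarrow> integrable M (\<lambda>\<omega>. (X i \<omega>)\<^sup>2)"
    and mean: "\<And>i. i \<in> A \<Longrightarrow> expectation (X i) = 0"
    and "\<epsilon> > 0"
  shows "prob {\<omega>\<in>space M. \<exists>k\<le>n. \<epsilon> \<le> \<bar>\<Sum>i\<in>A \<inter> {..<k}. X i \<omega>\<bar>}
           \<le> (\<Sum>i\<in>A \<inter> {..<n}. expectation (\<lambda>\<omega>. (X i \<omega>)\<^sup>2)) / \<epsilon>\<^sup>2"
proof -
  have [measurable]: "random_variable borel (X i)" if "i \<in> A" for i
    using ind that by (auto simp: indep_vars_def)
  define S where "S k x = (\<Sum>i\<in>A \<inter> {..<k}. x i)" for k and x :: "nat \<Rightarrow> real"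
  \<comment> \<open>\<open>S k\<close> involves only indices below \<open>k\<close>, so
    \<open>G k\<close> is a function of the variables preceding \<open>X k\<close>: whether the
    summand at \<open>k\<close> enters \<open>V\<close> is decided before it is seen. This makes the
    increments of \<open>V\<close> orthogonal.\<close>
  define G :: "nat \<Rightarrow> (nat \<Rightarrow> real) \<Rightarrow> real"
    where "G k x = (if \<forall>j\<le>k. \<bar>S j x\<bar> < \<epsilon> then 1 else 0)" for k x
  define V where "V k x = (\<Sum>i\<in>A \<inter> {..<k}. x i * G i x)" for k x
  let ?X = "\<lambda>\<omega> i. X i \<omega>"
  have AS: "A \<inter> {..<Suc k} = (if k \<in> A then insert k (A \<inter> {..<k}) else A \<inter> {..<k})" for k
    by (auto simp: lessThan_Suc)
  \<comment> \<open>\<open>S\<close>, \<open>G\<close> and \<open>V\<close> factor through the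
    coordinates below \<open>k\<close>; in this restricted form the independence of disjoint blocks
    of variables applies.\<close>
  have S_restrict: "S j (restrict x (A \<inter> {..<k})) = S j x" if "j \<le> k" for j k x
    unfolding S_def using that by (intro sum.cong) auto
  have G_restrict: "G j (restrict x (A \<inter> {..<k})) = G j x" if "j \<le> k" for j k x
    unfolding G_def using that by (auto simp: S_restrict)
  have V_restrict: "V j (restrict x (A \<inter> {..<k})) = V j x" if "j \<le> k" for j k x
    unfolding V_def using that by (intro sum.cong) (auto simp: G_restrict)
  have S_meas: "S j \<in> borel_measurable (PiM (A \<inter> {..<k}) (\<lambda>_. borel))" if "j \<le> k" for j k
    unfolding S_def using that
    by (intro borel_measurable_sum measurable_component_singleton) auto
  have G_meas: "G j \<in> borel_measurable (PiM (A \<inter> {..<k}) (\<lambda>_. borel))" if "j \<le> k" for j k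
  proof -
    have [measurable]: "S i \<in> borel_measurable (PiM (A \<inter> {..<k}) (\<lambda>_. borel))" if "i \<in> {..j}" for i
      using S_meas that \<open>j \<le> k\<close> by simp
    show ?thesis unfolding G_def Ball_def[symmetric] atMost_iff[symmetric] by measurable
  qed
  have V_meas: "V j \<in> borel_measurable (PiM (A \<inter> {..<k}) (\<lambda>_. borel))" if "j \<le> k" for j k
    unfolding V_def using that
    by (intro borel_measurable_sum borel_measurable_times measurable_component_singleton G_meas) auto
  have restr: "(\<lambda>\<omega>. restrict (?X \<omega>) (A \<inter> {..<k})) \<in> M \<rightarrow>\<^sub>M PiM (A \<inter> {..<k}) (\<lambda>_. borel)" for k
    by (intro measurable_restrict) auto
  have [measurable]: "(\<lambda>\<omega>. S k (?X \<omega>)) \<in> borel_measurable M"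
       "(\<lambda>\<omega>. V k (?X \<omega>)) \<in> borel_measurable M" "(\<lambda>\<omega>. G k (?X \<omega>)) \<in> borel_measurable M" for k
    using measurable_compose[OF restr S_meas, of k k] measurable_compose[OF restr V_meas, of k k]
      measurable_compose[OF restr G_meas, of k k]
    by (simp_all add: S_restrict V_restrict G_restrict)

  have step: "indep_var borel (\<lambda>\<omega>. f (restrict (?X \<omega>) (A \<inter> {..<k}))) borel (X k)"
    if "k \<in> A" "f \<in> borel_measurable (PiM (A \<inter> {..<k}) (\<lambda>_. borel))" for k and f :: "_ \<Rightarrow> real"
  proof -
    have 1: "indep_var (PiM (A \<inter> {..<k}) (\<lambda>_. borel)) (\<lambda>\<omega>. restrict (?X \<omega>) (A \<inter> {..<k}))
            (PiM {k} (\<lambda>_. borel)) (\<lambda>\<omega>. restrict (?X \<omega>) {k})"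
      by (rule indep_var_restrict[OF ind]) (use that in auto)
    have 2: "(\<lambda>x. x k) \<in> borel_measurable (PiM {k} (\<lambda>_. borel))"
      by (rule measurable_component_singleton) simp
    from indep_var_compose[OF 1 that(2) 2] show ?thesis by (simp add: comp_def)
  qed
  have V_sq: "integrable M (\<lambda>\<omega>. (V k (?X \<omega>))\<^sup>2) \<and>
      expectation (\<lambda>\<omega>. (V k (?X \<omega>))\<^sup>2) \<le> (\<Sum>i\<in>A \<inter> {..<k}. expectation (\<lambda>\<omega>. (X i \<omega>)\<^sup>2))" for k
  proof (induction k)
    case 0
    show ?case by (simp add: V_def)
  next
    case (Suc k)
    show ?case
    proof (cases "k \<in> A")
      case False
      then show ?thesis using Suc by (simp add: V_def AS)
    next
      case True
      note [measurable] = \<open>k \<in> A\<close>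
      \<comment> \<open>\<open>G k\<close> takes only the values 0 and 1, so its square in the last
        term is \<open>G k\<close> again. The cross term will have mean zero because
        \<open>V k * G k\<close> is independent of the centred \<open>X k\<close>.\<close>
      have Veq: "(V (Suc k) x)\<^sup>2 = (V k x)\<^sup>2 + 2 * (V k x * G k x * x k) + (x k)\<^sup>2 * G k x" for x
        using True by (simp add: V_def AS power2_eq_square algebra_simps) (simp add: G_def)
      have intV: "integrable M (\<lambda>\<omega>. (V k (?X \<omega>))\<^sup>2)" using Suc by simp
      have intVG: "integrable M (\<lambda>\<omega>. V k (?X \<omega>) * G k (?X \<omega>))"
        by (rule integrable_mult_of_square) (use intV in \<open>auto simp: G_def if_distrib intro!: integrable_const_bound[of _ 1]\<close>)
      have intX: "integrable M (X k)"
        using integrable_mult_of_square[where f = "X k" and g = "\<lambda>_. 1" and M = M] sq[OF True] True by simp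
      have iv: "indep_var borel (\<lambda>\<omega>. V k (?X \<omega>) * G k (?X \<omega>)) borel (X k)"
        using step[OF True, of "\<lambda>x. V k x * G k x"]
        by (simp add: V_restrict G_restrict V_meas G_meas borel_measurable_times)
      have intVGX: "integrable M (\<lambda>\<omega>. V k (?X \<omega>) * G k (?X \<omega>) * X k \<omega>)"
        by (rule indep_var_integrable[OF iv intVG intX])
      have zero: "expectation (\<lambda>\<omega>. V k (?X \<omega>) * G k (?X \<omega>) * X k \<omega>) = 0"
        using indep_var_lebesgue_integral[OF iv intVG intX] mean[OF True] by simp
      have le: "(X k \<omega>)\<^sup>2 * G k (?X \<omega>) \<le> (X k \<omega>)\<^sup>2" for \<omega> by (simp add: G_def)
      have intXG: "integrable M (\<lambda>\<omega>. (X k \<omega>)\<^sup>2 * G k (?X \<omega>))"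
        by (rule Bochner_Integration.integrable_bound[OF sq[OF True]])
           (use le in \<open>auto simp: G_def\<close>)
      have "expectation (\<lambda>\<omega>. (X k \<omega>)\<^sup>2 * G k (?X \<omega>)) \<le> expectation (\<lambda>\<omega>. (X k \<omega>)\<^sup>2)"
        by (intro integral_mono intXG sq True le)
      then show ?thesis
        using Suc True intV intVGX intXG zero by (simp add: Veq AS)
    qed
  qed

  have VS: "V k x = S k x" if "\<forall>j<k. \<bar>S j x\<bar> < \<epsilon>" for k x
    unfolding V_def S_def using that by (intro sum.cong) (auto simp: G_def S_def)
  \<comment> \<open>At the first crossing \<open>V\<close> equals \<open>S\<close>; afterwards
    \<open>G\<close> is 0 and \<open>V\<close> stays frozen. A single look at time \<open>k\<close>
    therefore detects every earlier crossing.\<close>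
  have dich: "\<epsilon> \<le> \<bar>V k x\<bar>" if "\<exists>j\<le>k. \<epsilon> \<le> \<bar>S j x\<bar>" for k x
    using that
  proof (induction k)
    case 0
    then show ?case using VS[of 0 x] by simp
  next
    case (Suc k)
    show ?case
    proof (cases "\<exists>j\<le>k. \<epsilon> \<le> \<bar>S j x\<bar>")
      case True
      then have "V (Suc k) x = V k x" by (auto simp: V_def AS G_def not_less)
      then show ?thesis using Suc.IH[OF True] by simp
    next
      case False
      then have "V (Suc k) x = S (Suc k) x" by (intro VS) (auto simp: less_Suc_eq_le)
      moreover have "\<epsilon> \<le> \<bar>S (Suc k) x\<bar>" using Suc.prems False le_Suc_eq by auto
      ultimately show ?thesis by simp
    qed
  qed

  have "prob {\<omega>\<in>space M. \<exists>k\<le>n. \<epsilon> \<le> \<bar>\<Sum>i\<in>A \<inter> {..<k}. X i \<omega>\<bar>}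
          \<le> prob {\<omega>\<in>space M. \<epsilon>\<^sup>2 \<le> (V n (?X \<omega>))\<^sup>2}"
  proof (rule finite_measure_mono)
    show "{\<omega>\<in>space M. \<epsilon>\<^sup>2 \<le> (V n (?X \<omega>))\<^sup>2} \<in> events" by measurable
    show "{\<omega>\<in>space M. \<exists>k\<le>n. \<epsilon> \<le> \<bar>\<Sum>i\<in>A \<inter> {..<k}. X i \<omega>\<bar>} \<subseteq> {\<omega>\<in>space M. \<epsilon>\<^sup>2 \<le> (V n (?X \<omega>))\<^sup>2}"
      using dich[of n] \<open>\<epsilon> > 0\<close> by (auto simp: S_def abs_le_square_iff[symmetric])
  qed
  also have "\<dots> \<le> expectation (\<lambda>\<omega>. (V n (?X \<omega>))\<^sup>2) / \<epsilon>\<^sup>2"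
    using V_sq[of n] \<open>\<epsilon> > 0\<close> by (intro integral_Markov_inequality_measure[where A = "{}"]) auto
  also have "\<dots> \<le> (\<Sum>i\<in>A \<inter> {..<n}. expectation (\<lambda>\<omega>. (X i \<omega>)\<^sup>2)) / \<epsilon>\<^sup>2"
    using V_sq[of n] by (intro divide_right_mono) auto
  finally show ?thesis .
qed

text \<open>The maximal inequality for the indices from \<open>m\<close> on bounds the oscillation
  of the partial sums after \<open>m\<close> by a tail of the variance series. These tails tend to
  0, so the partial sums are almost surely Cauchy.\<close>

theorem kolmogorov_one_series:
  fixes X :: "nat \<Rightarrow> 'a \<Rightarrow> real"
  assumes ind: "indep_vars (\<lambda>_. borel) X A"
    and sq: "\<And>i. i \<in> A \<Longrightarrow> integrable M (\<lambda>\<omega>. (X i \<omega>)\<^sup>2)"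
    and mean: "\<And>i. i \<in> A \<Longrightarrow> expectation (X i) = 0"
    and var: "summable (\<lambda>i. if i \<in> A then expectation (\<lambda>\<omega>. (X i \<omega>)\<^sup>2) else 0)"
  shows "AE \<omega> in M. summable (\<lambda>i. if i \<in> A then X i \<omega> else 0)"
proof -
  have [measurable]: "random_variable borel (X i)" if "i \<in> A" for i
    using ind that by (auto simp: indep_vars_def)
  define v where "v i = (if i \<in> A then expectation (\<lambda>\<omega>. (X i \<omega>)\<^sup>2) else 0)" for i
  have v0: "0 \<le> v i" for i by (simp add: v_def)
  define D where "D m k \<omega> = \<bar>\<Sum>i\<in>A \<inter> {m..<k}. X i \<omega>\<bar>" for m k \<omega>
  have [measurable]: "D m k \<in> borel_measurable M" for m k
    unfolding D_def by (intro borel_measurable_abs borel_measurable_sum) auto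
  have bound: "prob {\<omega>\<in>space M. \<exists>k. \<epsilon> \<le> D m k \<omega>} \<le> (\<Sum>i. v (i + m)) / \<epsilon>\<^sup>2" if "\<epsilon> > 0" for \<epsilon> m
  proof -
    define B where "B n = {\<omega>\<in>space M. \<exists>k\<le>n. \<epsilon> \<le> D m k \<omega>}" for n
    have [measurable]: "B n \<in> events" for n unfolding B_def by measurable
    \<comment> \<open>The maximal inequality has a finite horizon \<open>n\<close>; continuity of
      the measure from below removes it.\<close>
    have "incseq B" by (auto simp: incseq_def B_def intro: order_trans)
    then have "(\<lambda>n. prob (B n)) \<longlonglongrightarrow> prob (\<Union>n. B n)"
      by (intro finite_Lim_measure_incseq) auto
    moreover have "prob (B n) \<le> (\<Sum>i. v (i + m)) / \<epsilon>\<^sup>2" for n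
    proof -
      have eq: "A \<inter> {m..} \<inter> {..<k} = A \<inter> {m..<k}" for k by auto
      have "prob (B n) \<le> (\<Sum>i\<in>A \<inter> {m..} \<inter> {..<n}. expectation (\<lambda>\<omega>. (X i \<omega>)\<^sup>2)) / \<epsilon>\<^sup>2"
        using kolmogorov_maximal_inequality[of X "A \<inter> {m..}", OF indep_vars_subset[OF ind] sq mean that]
        unfolding B_def D_def eq by simp
      also have "(\<Sum>i\<in>A \<inter> {m..} \<inter> {..<n}. expectation (\<lambda>\<omega>. (X i \<omega>)\<^sup>2)) = (\<Sum>i\<in>A \<inter> {m..<n}. v i)"
        unfolding eq by (intro sum.cong) (auto simp: v_def)
      \<comment> \<open>Enlarging the range to \<open>n\<close> indices makes it an initial segment
        of the shifted series.\<close>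
      also have "\<dots> \<le> (\<Sum>i\<in>{m..<m+n}. v i)" by (intro sum_mono2) (auto simp: v0)
      also have "\<dots> = (\<Sum>i<n. v (i + m))"
        using sum.shift_bounds_nat_ivl[of v 0 m n] by (simp add: atLeast0LessThan add.commute)
      also have "\<dots> \<le> (\<Sum>i. v (i + m))"
        using var by (intro sum_le_suminf) (auto simp: v0 v_def[abs_def] summable_iff_shift[of v m, unfolded v_def])
      finally show ?thesis by (simp add: divide_right_mono)
    qed
    ultimately have "prob (\<Union>n. B n) \<le> (\<Sum>i. v (i + m)) / \<epsilon>\<^sup>2"
      by (intro LIMSEQ_le_const2) auto
    moreover have "(\<Union>n. B n) = {\<omega>\<in>space M. \<exists>k. \<epsilon> \<le> D m k \<omega>}" by (auto simp: B_def)
    ultimately show ?thesis by simp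
  qed
  have "AE \<omega> in M. \<exists>m. \<forall>k. D m k \<omega> < \<epsilon>" if "\<epsilon> > 0" for \<epsilon>
  proof -
    \<comment> \<open>\<open>N\<close> is the event that every tail oscillates by at least
      \<epsilon>. Its probability lies below the bound for each \<open>m\<close>, and these bounds
      tend to 0.\<close>
    define N where "N = {\<omega>\<in>space M. \<forall>m. \<exists>k. \<epsilon> \<le> D m k \<omega>}"
    have [measurable]: "N \<in> events" unfolding N_def by measurable
    have "prob N \<le> (\<Sum>i. v (i + m)) / \<epsilon>\<^sup>2" for m
    proof -
      have "prob N \<le> prob {\<omega>\<in>space M. \<exists>k. \<epsilon> \<le> D m k \<omega>}"
        by (intro finite_measure_mono) (auto simp: N_def)
      with bound[OF that, of m] show ?thesis by simp
    qed
    moreover have "(\<lambda>m. (\<Sum>i. v (i + m)) / \<epsilon>\<^sup>2) \<longlonglongrightarrow> 0 / \<epsilon>\<^sup>2"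
      by (intro tendsto_divide suminf_exist_split2 tendsto_const) (use var that in \<open>auto simp: v_def\<close>)
    ultimately have "prob N \<le> 0" by (intro LIMSEQ_le_const[where X = "\<lambda>m. (\<Sum>i. v (i + m)) / \<epsilon>\<^sup>2"]) auto
    then have "emeasure M N = 0" by (simp add: emeasure_eq_measure measure_le_0_iff)
    then have "AE \<omega> in M. \<omega> \<notin> N" by (intro AE_not_in) (simp add: null_sets_def)
    then show ?thesis by (rule AE_mp) (auto simp: N_def not_le)
  qed
  \<comment> \<open>Countably many thresholds \<open>1 / (j + 1)\<close> leave a single exceptional
    null set.\<close>
  then have "AE \<omega> in M. \<forall>j. \<exists>m. \<forall>k. D m k \<omega> < inverse (real (Suc j))"
    unfolding AE_all_countable by simp
  then show ?thesis
  proof (rule AE_mp, intro AE_I2 impI)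
    fix \<omega> assume *: "\<forall>j. \<exists>m. \<forall>k. D m k \<omega> < inverse (real (Suc j))"
    show "summable (\<lambda>i. if i \<in> A then X i \<omega> else 0)"
      unfolding summable_Cauchy
    proof (intro allI impI)
      fix e :: real assume "e > 0"
      \<comment> \<open>The half is there because a block from \<open>a\<close> to \<open>b\<close>
        is the difference of two sums starting at \<open>m\<close>.\<close>
      then obtain j where j: "inverse (real (Suc j)) < e / 2"
        using reals_Archimedean[of "e / 2"] by auto
      from * obtain m where m: "\<And>k. D m k \<omega> < inverse (real (Suc j))" by blast
      have eq: "(\<Sum>i\<in>{a..<b}. if i \<in> A then X i \<omega> else 0) = (\<Sum>i\<in>A \<inter> {a..<b}. X i \<omega>)" for a b
        by (simp add: sum.inter_restrict[symmetric] Int_commute)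
      have "norm (\<Sum>i\<in>{a..<b}. if i \<in> A then X i \<omega> else 0) < e" if "m \<le> a" for a b
      proof (cases "a \<le> b")
        case True
        have "(\<Sum>i\<in>{m..<a}. if i \<in> A then X i \<omega> else 0) + (\<Sum>i\<in>{a..<b}. if i \<in> A then X i \<omega> else 0)
                = (\<Sum>i\<in>{m..<b}. if i \<in> A then X i \<omega> else 0)"
          using that True by (rule sum.atLeastLessThan_concat)
        then show ?thesis using m[of a] m[of b] j unfolding eq D_def real_norm_def by linarith
      next
        case False
        then show ?thesis using \<open>e > 0\<close> by simp
      qed
      then show "\<exists>N. \<forall>m\<ge>N. \<forall>n. norm (\<Sum>i\<in>{m..<n}. if i \<in> A then X i \<omega> else 0) < e" by blast
    qed
  qed
qed

end

section \<open>Power series on the circle\<close>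

lemma cis_measurable [measurable]: "cis \<in> borel_measurable borel"
  by (intro borel_measurable_continuous_onI continuous_intros)

lemma cnj_measurable [measurable]: "cnj \<in> borel_measurable borel"
  by (intro borel_measurable_continuous_onI continuous_intros)

lemma sets_uniform_circle [measurable_cong, simp]: "sets uniform_circle = sets borel"
  by (simp add: uniform_circle_def)

lemma space_uniform_circle [simp]: "space uniform_circle = UNIV"
  by (simp add: uniform_circle_def)

text \<open>The endpoint \<open>2 * pi\<close> is a null set, so the half-open interval can be
  closed; the closed one is the form taken by the fundamental theorem of calculus.\<close>

lemma integral_uniform_circle:
  fixes f :: "complex \<Rightarrow> complex"
  assumes [measurable]: "f \<in> borel_measurable borel"
  shows "integral\<^sup>L uniform_circle f = (\<integral>\<theta>. indicator {0..2 * pi} \<theta> *\<^sub>R f (cis \<theta>) \<partial>lborel) / (2 * pi)"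
proof -
  have "integral\<^sup>L uniform_circle f = (\<integral>\<theta>. f (cis \<theta>) \<partial>uniform_measure lborel {0..<2 * pi})"
    unfolding uniform_circle_def by (rule integral_distr) (simp_all cong: measurable_cong_sets)
  also have "uniform_measure lborel {0..<2 * pi}
      = density lborel (\<lambda>\<theta>. ennreal (indicator {0..<2 * pi} \<theta> / (2 * pi)))"
    unfolding uniform_measure_def
    by (intro density_cong) (auto simp: divide_ennreal[symmetric] ennreal_indicator)
  also have "(\<integral>\<theta>. f (cis \<theta>) \<partial>\<dots>) = (\<integral>\<theta>. (indicator {0..<2 * pi} \<theta> / (2 * pi)) *\<^sub>R f (cis \<theta>) \<partial>lborel)"
    by (rule integral_density) auto
  also have "\<dots> = (\<integral>\<theta>. (indicator {0..2 * pi} \<theta> *\<^sub>R f (cis \<theta>)) / (2 * pi) \<partial>lborel)"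
  proof (rule integral_cong_AE)
    show "AE \<theta> in lborel. (indicator {0..<2 * pi} \<theta> / (2 * pi)) *\<^sub>R f (cis \<theta>)
            = indicator {0..2 * pi} \<theta> *\<^sub>R f (cis \<theta>) / complex_of_real (2 * pi)"
      using AE_lborel_singleton[of "2 * pi"]
      by eventually_elim (auto split: split_indicator simp: scaleR_conv_of_real field_simps)
  qed measurable
  finally show ?thesis by simp
qed

text \<open>Orthogonality of the characters: the integrand is \<open>cis (k * \<theta>)\<close> with
  \<open>k = n - m\<close>, and for \<open>k\<close> nonzero its antiderivative is
  \<open>2 * pi\<close>-periodic because \<open>k\<close> is an integer.\<close>

lemma integral_uniform_circle_powers:
  "(\<integral>w. w ^ n * cnj w ^ m \<partial>uniform_circle) = (if n = m then 1 else 0)"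
proof -
  define k where "k = real n - real m"
  have "cis \<theta> ^ n * cnj (cis \<theta>) ^ m = cis (k * \<theta>)" for \<theta>
    by (simp add: k_def Complex.DeMoivre cis_cnj cis_mult algebra_simps)
  then have "(\<integral>w. w ^ n * cnj w ^ m \<partial>uniform_circle)
      = (\<integral>\<theta>. indicator {0..2 * pi} \<theta> *\<^sub>R cis (k * \<theta>) \<partial>lborel) / (2 * pi)"
    by (subst integral_uniform_circle) auto
  also have "(\<integral>\<theta>. indicator {0..2 * pi} \<theta> *\<^sub>R cis (k * \<theta>) \<partial>lborel) = (if n = m then 2 * pi else 0)"
  proof (cases "n = m")
    case True
    then show ?thesis by (simp add: k_def scaleR_conv_of_real)
  next
    case False
    then have k: "k \<noteq> 0" by (simp add: k_def)
    \<comment> \<open>The derivative is taken in a complex variable and then restricted to the real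
      line.\<close>
    have "((\<lambda>\<theta>. cis (k * \<theta>) / (\<i> * k)) has_vector_derivative cis (k * \<theta>)) (at \<theta> within T)" for \<theta> T
    proof -
      have "((\<lambda>u. exp (\<i> * (k * u)) / (\<i> * k)) has_field_derivative exp (\<i> * (k * of_real \<theta>))) (at (of_real \<theta>))"
        by (rule derivative_eq_intros refl | simp add: k field_simps)+
      from has_vector_derivative_real_field[OF this] show ?thesis
        by (simp add: cis_conv_exp)
    qed
    then have "(\<integral>\<theta>. indicator {0..2 * pi} \<theta> *\<^sub>R cis (k * \<theta>) \<partial>lborel)
        = cis (k * (2 * pi)) / (\<i> * k) - cis (k * 0) / (\<i> * k)"
      by (intro integral_FTC_Icc) (auto intro!: continuous_intros)
    also have "cis (k * (2 * pi)) = 1"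
      using cis_multiple_2pi[of k] by (simp add: k_def mult.commute)
    finally show ?thesis using False by simp
  qed
  finally show ?thesis by simp
qed

lemma AE_uniform_circle_norm: "AE w in uniform_circle. norm w = 1"
  unfolding uniform_circle_def by (subst AE_distr_iff) (simp_all cong: measurable_cong_sets)

text \<open>Termwise integration: where \<open>norm w = 1\<close> the series is dominated by the
  absolutely summable coefficients times the bound on \<open>h\<close>.\<close>

lemma sums_integral_power_mult:
  fixes h :: "complex \<Rightarrow> complex"
  assumes M: "finite_measure M" and M_sets [measurable_cong]: "sets M = sets borel"
    and circ: "AE w in M. norm w = 1"
    and a: "summable (\<lambda>n. norm (a n))"
    and [measurable]: "h \<in> borel_measurable borel" and h: "AE w in M. norm (h w) \<le> B"
  shows "(\<lambda>n. a n * (\<integral>w. w ^ n * h w \<partial>M)) sums (\<integral>w. (\<Sum>n. a n * w ^ n) * h w \<partial>M)"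
proof -
  interpret finite_measure M by (rule M)
  have bd: "AE w in M. norm (w ^ n * h w) \<le> B" for n
    using circ h by eventually_elim (simp add: norm_mult norm_power)
  have int: "integrable M (\<lambda>w. w ^ n * h w)" for n
    by (rule integrable_const_bound[OF bd]) measurable
  have "(\<lambda>n. \<integral>w. a n * (w ^ n * h w) \<partial>M) sums (\<integral>w. (\<Sum>n. a n * (w ^ n * h w)) \<partial>M)"
  proof (rule sums_integral)
    show "integrable M (\<lambda>w. a n * (w ^ n * h w))" for n using int by simp
    show "AE w in M. summable (\<lambda>n. norm (a n * (w ^ n * h w)))"
      using circ
    proof eventually_elim
      case (elim w)
      then show ?case
        using summable_mult2[OF a, of "norm (h w)"] by (simp add: norm_mult norm_power mult_ac)
    qed
    show "summable (\<lambda>n. \<integral>w. norm (a n * (w ^ n * h w)) \<partial>M)"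
    proof (rule summable_comparison_test)
      have "(\<integral>w. norm (w ^ n * h w) \<partial>M) \<le> (\<integral>w. B \<partial>M)" for n
        using bd[of n] int by (intro integral_mono_AE) auto
      then show "\<exists>N. \<forall>n\<ge>N. norm (\<integral>w. norm (a n * (w ^ n * h w)) \<partial>M) \<le> norm (a n) * (\<integral>w. B \<partial>M)"
        by (auto simp: norm_mult[of "a _"] mult_left_mono)
      show "summable (\<lambda>n. norm (a n) * (\<integral>w. B \<partial>M))" by (rule summable_mult2[OF a])
    qed
  qed
  also have "(\<integral>w. (\<Sum>n. a n * (w ^ n * h w)) \<partial>M) = (\<integral>w. (\<Sum>n. a n * w ^ n) * h w \<partial>M)"
  proof (rule integral_cong_AE)
    show "AE w in M. (\<Sum>n. a n * (w ^ n * h w)) = (\<Sum>n. a n * w ^ n) * h w"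
      using circ
    proof eventually_elim
      case (elim w)
      then have "summable (\<lambda>n. norm (a n * w ^ n))" using a by (simp add: norm_mult norm_power)
      from suminf_mult2[OF summable_norm_cancel[OF this], of "h w"] show ?case
        by (simp add: mult.assoc)
    qed
  qed measurable
  finally show ?thesis by simp
qed

text \<open>A Parseval identity, by two termwise integrations: the second series paired with
  \<open>w ^ n\<close> leaves only \<open>b n\<close>, and then the first series is integrated
  against the second.\<close>

lemma sums_integral_uniform_circle_product:
  assumes a: "summable (\<lambda>n. norm (a n))" and b: "summable (\<lambda>n. norm (b n))"
  shows "(\<lambda>n. a n * b n) sums (\<integral>w. (\<Sum>n. a n * w ^ n) * (\<Sum>n. b n * cnj w ^ n) \<partial>uniform_circle)"
proof -
  interpret prob_space uniform_circle by (rule prob_space_uniform_circle)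
  note cd = finite_measure_axioms sets_uniform_circle AE_uniform_circle_norm
  have "(\<integral>w. w ^ n * (\<Sum>m. b m * cnj w ^ m) \<partial>uniform_circle) = b n" for n
  proof -
    \<comment> \<open>Termwise integration is available for powers of \<open>w\<close>, not of
      \<open>cnj w\<close>, so the conjugate of the wanted integral is computed first.\<close>
    have "(\<lambda>m. cnj (b m) * (\<integral>w. w ^ m * cnj w ^ n \<partial>uniform_circle)) sums
            (\<integral>w. (\<Sum>m. cnj (b m) * w ^ m) * cnj w ^ n \<partial>uniform_circle)"
    proof (rule sums_integral_power_mult[OF cd])
      show "summable (\<lambda>n. norm (cnj (b n)))" using b by simp
      show "AE w in uniform_circle. norm (cnj w ^ n) \<le> 1"
        using AE_uniform_circle_norm by eventually_elim (simp add: norm_power)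
    qed measurable
    then have "(\<integral>w. (\<Sum>m. cnj (b m) * w ^ m) * cnj w ^ n \<partial>uniform_circle) = cnj (b n)"
      using sums_unique2[OF _ sums_single[of n "\<lambda>m. cnj (b m)"]]
      by (simp add: integral_uniform_circle_powers if_distrib[of "(*) _"] cong: if_cong)
    then have "(\<integral>w. cnj ((\<Sum>m. cnj (b m) * w ^ m) * cnj w ^ n) \<partial>uniform_circle) = b n"
      by (subst Bochner_Integration.integral_cnj) simp
    then have "(\<integral>w. cnj (\<Sum>m. cnj (b m) * w ^ m) * w ^ n \<partial>uniform_circle) = b n"
      by simp
    moreover have "(\<integral>w. cnj (\<Sum>m. cnj (b m) * w ^ m) * w ^ n \<partial>uniform_circle)
        = (\<integral>w. w ^ n * (\<Sum>m. b m * cnj w ^ m) \<partial>uniform_circle)"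
    proof (rule integral_cong_AE)
      show "AE w in uniform_circle. cnj (\<Sum>m. cnj (b m) * w ^ m) * w ^ n = w ^ n * (\<Sum>m. b m * cnj w ^ m)"
        using AE_uniform_circle_norm
      proof eventually_elim
        case (elim w)
        then have "summable (\<lambda>n. norm (cnj (b n) * w ^ n))" using b by (simp add: norm_mult norm_power)
        from summable_sums[OF summable_norm_cancel[OF this]]
        have "(\<lambda>n. b n * cnj w ^ n) sums cnj (\<Sum>m. cnj (b m) * w ^ m)"
          by (subst sums_cnj[symmetric]) simp
        then show ?case by (simp add: sums_iff mult.commute)
      qed
    qed measurable
    ultimately show ?thesis by simp
  qed
  moreover have "(\<lambda>n. a n * (\<integral>w. w ^ n * (\<Sum>m. b m * cnj w ^ m) \<partial>uniform_circle)) sums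
      (\<integral>w. (\<Sum>n. a n * w ^ n) * (\<Sum>m. b m * cnj w ^ m) \<partial>uniform_circle)"
  proof (rule sums_integral_power_mult[OF cd a])
    show "AE w in uniform_circle. norm (\<Sum>m. b m * cnj w ^ m) \<le> (\<Sum>m. norm (b m))"
      using AE_uniform_circle_norm
    proof eventually_elim
      case (elim w)
      then show ?case using summable_norm[of "\<lambda>m. b m * cnj w ^ m"] b
        by (simp add: norm_mult norm_power)
    qed
  qed measurable
  ultimately show ?thesis by simp
qed

section \<open>The Euler product\<close>

lemma bounded_of_eventually_decreasing:
  fixes d :: "nat \<Rightarrow> real"
  assumes "\<And>n. n \<ge> N \<Longrightarrow> d (Suc n) \<le> d n"
  shows "\<exists>C. \<forall>n. d n \<le> C"
proof (intro exI allI)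
  fix n
  show "d n \<le> Max (d ` {..N})"
  proof (induction n)
    case (Suc n)
    then show ?case
      using assms[of n] by (cases "n \<ge> N") (auto intro: order_trans)
  qed simp
qed

text \<open>Replacing each factor by \<open>j^2 + K^2\<close> gives a majorant \<open>d n\<close>
  whose consecutive ratio \<open>(n^2 + K^2) / (n + 1)^2\<close> is at most 1 as soon as
  \<open>n\<close> is at least \<open>K^2\<close>.\<close>

lemma binomial_product_bounded:
  "\<exists>C\<ge>0. \<forall>n (x::complex). norm x \<le> K \<longrightarrow> norm (1 / (fact n)\<^sup>2 * (\<Prod>j<n. (of_nat j)\<^sup>2 - x\<^sup>2)) \<le> C"
proof -
  define d where "d n = (\<Prod>j<n. (real j)\<^sup>2 + K\<^sup>2) / (fact n)\<^sup>2" for n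
  have d0: "0 \<le> d n" for n unfolding d_def by (intro divide_nonneg_nonneg prod_nonneg) auto
  have "d (Suc n) \<le> d n" if "n \<ge> nat \<lceil>K\<^sup>2\<rceil>" for n
  proof -
    have "d (Suc n) = d n * (((real n)\<^sup>2 + K\<^sup>2) / (real (Suc n))\<^sup>2)"
      by (simp add: d_def power_mult_distrib)
    also have "\<dots> \<le> d n * 1"
    proof (intro mult_left_mono d0)
      have "K\<^sup>2 \<le> real n" using that by linarith
      then have "(real n)\<^sup>2 + K\<^sup>2 \<le> (real (Suc n))\<^sup>2" by (simp add: power2_eq_square algebra_simps)
      then show "((real n)\<^sup>2 + K\<^sup>2) / (real (Suc n))\<^sup>2 \<le> 1" by (simp del: of_nat_Suc)
    qed
    finally show ?thesis by simp
  qed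
  then obtain C where C: "\<And>n. d n \<le> C" using bounded_of_eventually_decreasing by blast
  have "norm (1 / (fact n)\<^sup>2 * (\<Prod>j<n. (of_nat j)\<^sup>2 - x\<^sup>2)) \<le> C" if "norm x \<le> K" for n and x :: complex
  proof -
    have "norm (\<Prod>j<n. (of_nat j)\<^sup>2 - x\<^sup>2) \<le> (\<Prod>j<n. (real j)\<^sup>2 + K\<^sup>2)"
      unfolding prod_norm[symmetric]
    proof (intro prod_mono conjI norm_ge_zero)
      fix j
      have "norm ((of_nat j)\<^sup>2 - x\<^sup>2) \<le> (real j)\<^sup>2 + (norm x)\<^sup>2"
        by (rule order_trans[OF norm_triangle_ineq4]) (simp add: norm_power)
      also have "(norm x)\<^sup>2 \<le> K\<^sup>2" using that by (intro power_mono) auto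
      finally show "norm ((of_nat j)\<^sup>2 - x\<^sup>2) \<le> (real j)\<^sup>2 + K\<^sup>2" by simp
    qed
    then have "norm (1 / (fact n)\<^sup>2 * (\<Prod>j<n. (of_nat j)\<^sup>2 - x\<^sup>2)) \<le> d n"
      by (simp add: d_def norm_mult norm_divide norm_power divide_right_mono)
    with C[of n] show ?thesis by simp
  qed
  moreover have "0 \<le> C" using C[of 0] d0[of 0] by simp
  ultimately show ?thesis by blast
qed

text \<open>\<open>C\<close> depends on \<open>K\<close> alone. Uniformity in \<open>n\<close> and
  \<open>x\<close> serves the M-test inside one factor, uniformity in \<open>p\<close> the sum over
  the primes.\<close>

lemma factor_term_bounded:
  obtains C where "0 \<le> C"
    "\<And>\<sigma> p x n. norm x \<le> K \<Longrightarrow> p > 0 \<Longrightarrow> norm (factor_term \<sigma> p x n) \<le> C * (real p powr (-2 * \<sigma>)) ^ n"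
proof -
  obtain C where C: "C \<ge> 0"
    "\<And>n (x::complex). norm x \<le> K \<Longrightarrow> norm (1 / (fact n)\<^sup>2 * (\<Prod>j<n. (of_nat j)\<^sup>2 - x\<^sup>2)) \<le> C"
    using binomial_product_bounded[of K] by blast
  have "norm (factor_term \<sigma> p x n) \<le> C * (real p powr (-2 * \<sigma>)) ^ n" if "norm x \<le> K" "p > 0" for \<sigma> p x n
  proof -
    have eq: "1 / real p powr (2 * real n * \<sigma>) = (real p powr (-2 * \<sigma>)) ^ n"
      using \<open>p > 0\<close> by (simp add: powr_power powr_minus_divide[symmetric] mult_ac)
    show ?thesis
      unfolding factor_term_def eq norm_mult[of "_ * _"] 
      by (rule mult_mono[OF C(2)[OF that(1)]]) (simp_all add: norm_power C(1))
  qed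
  with C(1) show ?thesis by (rule that)
qed

text \<open>The ratio of the geometric majorants stays at or below 1/2, so their sums are controlled
  uniformly in \<open>p\<close>.\<close>

lemma prime_powr_bounds:
  assumes "prime p" "\<sigma> > 1 / 2"
  shows "0 < real p powr (-2 * \<sigma>)" "real p powr (-2 * \<sigma>) \<le> 1 / 2"
proof -
  have p: "real p \<ge> 2" using prime_ge_2_nat[OF assms(1)] by simp
  then show "0 < real p powr (-2 * \<sigma>)" by simp
  have "real p powr (-2 * \<sigma>) \<le> real p powr (-1)" using p assms(2) by (intro powr_mono) auto
  also have "\<dots> \<le> 1 / 2" using p by (simp add: powr_minus_divide)
  finally show "real p powr (-2 * \<sigma>) \<le> 1 / 2" .
qed

lemma summable_factor_term:
  assumes "prime p" "\<sigma> > 1 / 2"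
  shows "summable (\<lambda>n. factor_term \<sigma> p x (Suc n))"
proof -
  obtain C where "0 \<le> C" and C: "\<And>\<sigma> p y n. norm y \<le> norm x \<Longrightarrow> p > 0 \<Longrightarrow> norm (factor_term \<sigma> p y n) \<le> C * (real p powr (-2 * \<sigma>)) ^ n"
    using factor_term_bounded[of "norm x"] by blast
  have "summable (\<lambda>n. factor_term \<sigma> p x n)"
  proof (rule summable_comparison_test)
    show "\<exists>N. \<forall>n\<ge>N. norm (factor_term \<sigma> p x n) \<le> C * (real p powr (-2 * \<sigma>)) ^ n"
      using C[OF _ prime_gt_0_nat[OF assms(1)], of _ \<sigma>] by simp
    show "summable (\<lambda>n. C * (real p powr (-2 * \<sigma>)) ^ n)"
      using prime_powr_bounds[OF assms] by (intro summable_mult summable_geometric) auto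
  qed
  then show ?thesis by (simp add: summable_Suc_iff)
qed

lemma euler_factor_eq_suminf:
  assumes "prime p" "\<sigma> > 1 / 2"
  shows "euler_factor \<sigma> p x = (\<Sum>n. factor_term \<sigma> p x n)"
proof -
  have "summable (\<lambda>n. factor_term \<sigma> p x n)"
    using summable_factor_term[OF assms] by (simp add: summable_Suc_iff)
  from suminf_split_head[OF this] show ?thesis
    using prime_gt_0_nat[OF assms(1)] by (simp add: euler_factor_def factor_term_def)
qed

text \<open>Without the leading 1 the majorant is a geometric series starting at
  \<open>C * q\<close>; since \<open>q\<close> is at most 1/2, its sum is at most
  \<open>2 * C * q\<close>.\<close>

lemma euler_factor_bounded:
  obtains C where "\<And>\<sigma> p x. norm x \<le> K \<Longrightarrow> prime p \<Longrightarrow> \<sigma> > 1 / 2 \<Longrightarrow>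
     norm (euler_factor \<sigma> p x - 1) \<le> C * real p powr (-2 * \<sigma>)"
proof -
  obtain C where C: "C \<ge> 0" "\<And>\<sigma> p y n. norm y \<le> K \<Longrightarrow> p > 0 \<Longrightarrow> norm (factor_term \<sigma> p y n) \<le> C * (real p powr (-2 * \<sigma>)) ^ n"
    using factor_term_bounded[of K] by blast
  have "norm (euler_factor \<sigma> p x - 1) \<le> (2 * C) * real p powr (-2 * \<sigma>)"
    if x: "norm x \<le> K" and p: "prime p" and \<sigma>: "\<sigma> > 1 / 2" for \<sigma> p x
  proof -
    define q where "q = real p powr (-2 * \<sigma>)"
    have q: "0 < q" "q \<le> 1 / 2" using prime_powr_bounds[OF p \<sigma>] by (auto simp: q_def)
    have sums: "(\<lambda>n. C * q ^ Suc n) sums (C * q * (1 / (1 - q)))"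
      using sums_mult[OF geometric_sums[of q], of "C * q"] q by (simp add: mult_ac)
    have "norm (\<Sum>n. factor_term \<sigma> p x (Suc n)) \<le> (\<Sum>n. C * q ^ Suc n)"
      unfolding q_def
      by (rule norm_suminf_le) (use C(2)[OF x prime_gt_0_nat[OF p], of \<sigma> "Suc _"] sums_summable[OF sums] q_def in auto)
    also have "\<dots> = C * q * (1 / (1 - q))" using sums by (simp add: sums_iff)
    also have "\<dots> \<le> C * q * 2"
      using q C(1) by (intro mult_left_mono) (auto simp: field_simps)
    finally show ?thesis by (simp add: euler_factor_def q_def mult_ac)
  qed
  then show ?thesis by (rule that)
qed

text \<open>The partial sums are polynomials in \<open>x\<close> and converge uniformly on each
  closed disc of radius 1 by the M-test.\<close>

lemma euler_factor_holomorphic: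
  assumes "prime p" "\<sigma> > 1 / 2"
  shows "euler_factor \<sigma> p holomorphic_on UNIV"
proof (rule holomorphic_uniform_sequence)
  show "(\<lambda>x. \<Sum>n<N. factor_term \<sigma> p x n) holomorphic_on UNIV" for N
    unfolding factor_term_def by (intro holomorphic_intros) auto
  fix x :: complex
  obtain C where "0 \<le> C" and C: "\<And>\<sigma> p y n. norm y \<le> norm x + 1 \<Longrightarrow> p > 0 \<Longrightarrow> norm (factor_term \<sigma> p y n) \<le> C * (real p powr (-2 * \<sigma>)) ^ n"
    using factor_term_bounded[of "norm x + 1"] by blast
  have "uniform_limit (cball x 1) (\<lambda>N x. \<Sum>n<N. factor_term \<sigma> p x n) (\<lambda>x. \<Sum>n. factor_term \<sigma> p x n) sequentially"
  proof (rule Weierstrass_m_test)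
    fix n y assume "y \<in> cball x 1"
    then have "norm y \<le> norm x + 1" using norm_triangle_ineq2[of y x] by (simp add: dist_norm norm_minus_commute)
    then show "norm (factor_term \<sigma> p y n) \<le> C * (real p powr (-2 * \<sigma>)) ^ n"
      using C[OF _ prime_gt_0_nat[OF assms(1)], of _ \<sigma>] by simp
  next
    show "summable (\<lambda>n. C * (real p powr (-2 * \<sigma>)) ^ n)"
      using prime_powr_bounds[OF assms] by (intro summable_mult summable_geometric) auto
  qed
  then show "\<exists>d>0. cball x d \<subseteq> UNIV \<and>
      uniform_limit (cball x d) (\<lambda>N x. \<Sum>n<N. factor_term \<sigma> p x n) (euler_factor \<sigma> p) sequentially"
    unfolding euler_factor_eq_suminf[OF assms, abs_def] by (intro exI[of _ 1]) simp
qed simp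

section \<open>Convergence and holomorphy of the product over all primes\<close>

lemma summable_norm_euler_factor:
  assumes "\<sigma> > 1 / 2"
  obtains B :: "nat \<Rightarrow> real" where "summable B"
    "\<And>p x. norm x \<le> K \<Longrightarrow> norm ((if prime p then euler_factor \<sigma> p x else 1) - 1) \<le> B p"
proof -
  obtain C where C: "\<And>\<sigma> p x. norm x \<le> K \<Longrightarrow> prime p \<Longrightarrow> \<sigma> > 1 / 2 \<Longrightarrow>
     norm (euler_factor \<sigma> p x - 1) \<le> C * real p powr (-2 * \<sigma>)"
    using euler_factor_bounded[of K] by blast
  show ?thesis
  proof
    \<comment> \<open>The majorant is summed over all natural numbers and converges since
      \<open>2 * \<sigma> > 1\<close>. The absolute value makes it nonnegative, as \<open>C\<close>
      comes without a sign.\<close>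
    show "summable (\<lambda>p. \<bar>C\<bar> * real p powr (-2 * \<sigma>))"
      using assms by (intro summable_mult) (simp add: summable_real_powr_iff)
    fix p and x :: complex assume x: "norm x \<le> K"
    have "norm (euler_factor \<sigma> p x - 1) \<le> \<bar>C\<bar> * real p powr (-2 * \<sigma>)" if "prime p"
      by (rule order_trans[OF C[OF x that assms]]) (intro mult_right_mono, auto)
    then show "norm ((if prime p then euler_factor \<sigma> p x else 1) - 1) \<le> \<bar>C\<bar> * real p powr (-2 * \<sigma>)"
      by auto
  qed
qed

text \<open>The product converges absolutely. \<open>has_prod\<close> admits finitely many vanishing
  factors, so zeros of single factors do no harm.\<close>

lemma euler_product_has_prod:
  assumes "\<sigma> > 1 / 2"
  shows "(\<lambda>p. if prime p then euler_factor \<sigma> p x else 1) has_prod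
           (\<Prod>p. if prime p then euler_factor \<sigma> p x else 1)"
proof -
  obtain B :: "nat \<Rightarrow> real" where B: "summable B"
    "\<And>p y. norm y \<le> norm x \<Longrightarrow> norm ((if prime p then euler_factor \<sigma> p y else 1) - 1) \<le> B p"
    using summable_norm_euler_factor[OF assms, of "norm x"] by blast
  have "summable (\<lambda>p. norm ((if prime p then euler_factor \<sigma> p x else 1) - 1))"
    by (rule summable_comparison_test[OF _ B(1)]) (use B(2)[of x] in auto)
  then show ?thesis
    by (intro convergent_prod_has_prod abs_convergent_prod_imp_convergent_prod summable_imp_abs_convergent_prod)
qed

text \<open>The majorant does not depend on \<open>x\<close> within a disc, so the partial products
  converge locally uniformly and the limit inherits holomorphy.\<close>

lemma euler_product_holomorphic:
  assumes "\<sigma> > 1 / 2"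
  shows "(\<lambda>x. \<Prod>p. if prime p then euler_factor \<sigma> p x else 1) holomorphic_on UNIV"
proof -
  define f where "f p x = (if prime p then euler_factor \<sigma> p x else 1)" for p x
  have holo: "f p holomorphic_on UNIV" for p
    using euler_factor_holomorphic[OF _ assms, of p] by (cases "prime p") (auto simp: f_def[abs_def])
  have lim: "(\<lambda>N. \<Prod>p<N. f p x) \<longlonglongrightarrow> (\<Prod>p. f p x)" for x
    unfolding f_def by (rule has_prod_imp_tendsto'[OF euler_product_has_prod[OF assms]])
  have "(\<lambda>x. \<Prod>p. f p x) holomorphic_on UNIV"
  proof (rule holomorphic_uniform_sequence)
    show "(\<lambda>x. \<Prod>p<N. f p x) holomorphic_on UNIV" for N
      by (intro holomorphic_intros holo)
    fix x :: complex
    obtain B :: "nat \<Rightarrow> real" where B: "summable B"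
      "\<And>p y. norm y \<le> norm x + 1 \<Longrightarrow> norm ((if prime p then euler_factor \<sigma> p y else 1) - 1) \<le> B p"
      using summable_norm_euler_factor[OF assms, of "norm x + 1"] by blast
    have "uniformly_convergent_on (cball x 1) (\<lambda>N y. \<Prod>p<N. f p y)"
    proof (rule uniformly_convergent_on_prod')
      show "continuous_on (cball x 1) (f p)" for p
        using holo[of p] holomorphic_on_imp_continuous_on continuous_on_subset by blast
      show "uniformly_convergent_on (cball x 1) (\<lambda>N y. \<Sum>p<N. norm (f p y - 1))"
      proof (rule Weierstrass_m_test'[OF _ B(1)])
        fix p y assume "y \<in> cball x 1"
        then have "norm y \<le> norm x + 1" using norm_triangle_ineq2[of y x] by (simp add: dist_norm norm_minus_commute)
        from B(2)[OF this] show "norm (norm (f p y - 1)) \<le> B p" by (simp add: f_def)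
      qed
    qed simp
    then obtain g where g: "uniform_limit (cball x 1) (\<lambda>N y. \<Prod>p<N. f p y) g sequentially"
      by (auto simp: uniformly_convergent_on_def)
    \<comment> \<open>The uniform limit is so far anonymous; pointwise uniqueness of limits
      identifies it with the infinite product.\<close>
    have "g y = (\<Prod>p. f p y)" if "y \<in> cball x 1" for y
      using tendsto_uniform_limitI[OF g that] lim LIMSEQ_unique by blast
    then have "uniform_limit (cball x 1) (\<lambda>N y. \<Prod>p<N. f p y) (\<lambda>y. \<Prod>p. f p y) sequentially"
      using g by (subst uniform_limit_cong'[where g = "\<lambda>N y. \<Prod>p<N. f p y" and i = g]) auto
    then show "\<exists>d>0. cball x d \<subseteq> UNIV \<and>
        uniform_limit (cball x d) (\<lambda>N y. \<Prod>p<N. f p y) (\<lambda>y. \<Prod>p. f p y) sequentially"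
      by (intro exI[of _ 1]) simp
  qed simp
  then show ?thesis by (simp add: f_def)
qed

section \<open>The random Euler product\<close>

lemma prime_powr_less_one:
  assumes "prime p" "\<sigma> > 1 / 2"
  shows "0 < real p powr - \<sigma>" "real p powr - \<sigma> \<le> 3 / 4" "(real p powr - \<sigma>)\<^sup>2 = real p powr (-2 * \<sigma>)"
proof -
  define r where "r = real p powr - \<sigma>"
  show eq: "(real p powr - \<sigma>)\<^sup>2 = real p powr (-2 * \<sigma>)"
    using prime_gt_0_nat[OF assms(1)] by (simp add: powr_power)
  show "0 < real p powr - \<sigma>" using prime_gt_0_nat[OF assms(1)] by simp
  \<comment> \<open>The square is at most 1/2, which is below 9/16; 3/4 is a rational substitute for
    the square root of 1/2.\<close>
  have "r\<^sup>2 \<le> (3 / 4)\<^sup>2"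
    using prime_powr_bounds(2)[OF assms] unfolding eq[symmetric] r_def by (simp add: power2_eq_square)
  then show "real p powr - \<sigma> \<le> 3 / 4" unfolding r_def by (rule power2_le_imp_le) simp
qed

text \<open>The error of the linear approximation is at most \<open>norm z\<close> times
  \<open>norm z / (1 - norm z)\<close>, and this quotient is at most 3 in the given disc; the linear
  term adds 1.\<close>

lemma Ln_one_minus_bound:
  fixes z :: complex
  assumes "norm z \<le> 3 / 4"
  shows "norm (Ln (1 - z)) \<le> 4 * norm z"
proof -
  have "norm (Ln (1 - z)) \<le> norm (Ln (1 + - z) - (- z)) + norm z"
    using norm_triangle_ineq[of "Ln (1 - z) + z" "- z"] by simp
  also have "\<dots> \<le> (norm z)\<^sup>2 / (1 - norm z) + norm z"
    using Ln_approx_linear[of "- z"] assms by simp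
  also have "(norm z)\<^sup>2 / (1 - norm z) \<le> 3 * norm z"
  proof -
    have "norm z * norm z \<le> norm z * (3 * (1 - norm z))"
      using assms by (intro mult_left_mono) auto
    then show ?thesis using assms by (simp add: divide_simps power2_eq_square mult_ac)
  qed
  finally show ?thesis by simp
qed

text \<open>\<open>1 - r * w\<close> has positive real part. Being off the branch cut allows
  conjugation to be exchanged with \<open>Ln\<close>.\<close>

lemma AE_uniform_circle_in_disc:
  assumes "0 < r" "r < 1"
  shows "AE w in uniform_circle. norm (of_real r * w) = r \<and> 1 - of_real r * w \<notin> \<real>\<^sub>\<le>\<^sub>0"
  using AE_uniform_circle_norm
proof eventually_elim
  case (elim w)
  then have "norm (of_real r * w) = r" using assms by (simp add: norm_mult)
  moreover have "Re (of_real r * w) < 1"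
    using complex_Re_le_cmod[of "of_real r * w"] calculation assms by linarith
  ultimately show ?case by (auto simp: complex_nonpos_Reals_iff)
qed

text \<open>The power series of the logarithm has no constant term, and every other power of
  \<open>w\<close> has mean zero.\<close>

lemma integral_uniform_circle_Ln:
  assumes "0 < r" "r < 1"
  shows "(\<integral>w. Ln (1 - of_real r * w) \<partial>uniform_circle) = 0"
proof -
  interpret prob_space uniform_circle by (rule prob_space_uniform_circle)
  \<comment> \<open>At \<open>n = 0\<close> division by zero yields 0, which is the correct constant
    term.\<close>
  define a where "a n = - (of_real r ^ n) / (of_nat n :: complex)" for n
  have "(\<lambda>n. a n * (\<integral>w. w ^ n * 1 \<partial>uniform_circle)) sums (\<integral>w. (\<Sum>n. a n * w ^ n) * 1 \<partial>uniform_circle)"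
  proof (rule sums_integral_power_mult[OF finite_measure_axioms sets_uniform_circle AE_uniform_circle_norm])
    show "summable (\<lambda>n. norm (a n))"
    proof (rule summable_comparison_test)
      show "\<exists>N. \<forall>n\<ge>N. norm (norm (a n)) \<le> r ^ n"
        using assms by (auto simp: a_def norm_divide norm_power field_simps intro!: exI[of _ 1])
      show "summable (\<lambda>n. r ^ n)" using assms by (intro summable_geometric) simp
    qed
  qed auto
  also have "(\<lambda>n. a n * (\<integral>w. w ^ n * 1 \<partial>uniform_circle)) = (\<lambda>n. 0)"
    using integral_uniform_circle_powers[of _ 0] by (auto simp: a_def fun_eq_iff)
  finally have "(\<integral>w. (\<Sum>n. a n * w ^ n) * 1 \<partial>uniform_circle) = 0"
    using sums_unique2 sums_zero by blast
  moreover have "(\<integral>w. Ln (1 - of_real r * w) \<partial>uniform_circle) = (\<integral>w. (\<Sum>n. a n * w ^ n) * 1 \<partial>uniform_circle)"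
  proof (rule integral_cong_AE)
    show "AE w in uniform_circle. Ln (1 - of_real r * w) = (\<Sum>n. a n * w ^ n) * 1"
      using AE_uniform_circle_in_disc[OF assms]
    proof eventually_elim
      case (elim w)
      then have "(\<lambda>n. a n * w ^ n) sums Ln (1 - of_real r * w)"
        using Ln_series'[of "- (of_real r * w)"] assms
        by (simp add: a_def power_mult_distrib)
      then show ?case by (simp add: sums_iff)
    qed
  qed measurable
  ultimately show ?thesis by simp
qed

text \<open>Factor by factor, \<open>(- x - j) * (x - j) = j^2 - x^2\<close>. This is where the
  coefficients of the Euler factor come from.\<close>

lemma gbinomial_mult_minus:
  fixes x :: complex
  shows "(- x gchoose n) * (x gchoose n) = 1 / (fact n)\<^sup>2 * (\<Prod>j<n. (of_nat j)\<^sup>2 - x\<^sup>2)"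
proof -
  have "(\<Prod>j<n. - x - of_nat j) * (\<Prod>j<n. x - of_nat j) = (\<Prod>j<n. (of_nat j)\<^sup>2 - x\<^sup>2)"
    unfolding prod.distrib[symmetric] by (intro prod.cong) (auto simp: power2_eq_square algebra_simps)
  then show ?thesis
    by (simp add: gbinomial_prod_rev atLeast0LessThan power2_eq_square)
qed

lemma summable_norm_gbinomial:
  fixes a z :: complex
  assumes "norm z < 1"
  shows "summable (\<lambda>n. norm ((a gchoose n) * z ^ n))"
  by (rule abs_summable_in_conv_radius) (use assms in \<open>simp add: conv_radius_gchoose one_ereal_def\<close>)

lemma integral_uniform_circle_euler_factor:
  assumes p: "prime p" and \<sigma>: "\<sigma> > 1 / 2"
  shows "(\<integral>w. iexp (t * (- Im (Ln (1 - of_real (real p powr - \<sigma>) * w)))) \<partial>uniform_circle)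
          = euler_factor \<sigma> p (of_real t / 2)"
proof -
  define r where "r = real p powr - \<sigma>"
  have r: "0 < r" "r < 1" using prime_powr_less_one[OF p \<sigma>] by (auto simp: r_def)
  \<comment> \<open>The halving is the change of variable in \<open>psi (2 * x)\<close>: the
    difference \<open>cnj (Ln u) - Ln u\<close> below produces twice
    \<open>Im (Ln u)\<close>.\<close>
  define x where "x = complex_of_real t / 2"
  have cnj_x: "cnj x = x" by (simp add: x_def)
  define a where "a n = (- x gchoose n) * (- of_real r) ^ n" for n
  define b where "b n = (x gchoose n) * (- of_real r) ^ n" for n
  have ab: "summable (\<lambda>n. norm (a n))" "summable (\<lambda>n. norm (b n))"
    unfolding a_def b_def using r by (intro summable_norm_gbinomial; simp)+
  have "a n * b n = factor_term \<sigma> p x n" for n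
  proof -
    have "1 / real p powr (2 * real n * \<sigma>) = r ^ (2 * n)"
      using prime_gt_0_nat[OF p] by (simp add: r_def powr_power powr_minus_divide[symmetric] mult_ac)
    then have "factor_term \<sigma> p x n = (- x gchoose n) * (x gchoose n) * of_real r ^ (2 * n)"
      unfolding factor_term_def gbinomial_mult_minus by simp
    then show ?thesis
      by (simp add: a_def b_def power_mult power_mult_distrib[symmetric] power2_eq_square)
  qed
  then have "(\<lambda>n. factor_term \<sigma> p x n) sums
      (\<integral>w. (\<Sum>n. a n * w ^ n) * (\<Sum>n. b n * cnj w ^ n) \<partial>uniform_circle)"
    using sums_integral_uniform_circle_product[OF ab] by simp
  moreover have "(\<integral>w. iexp (t * (- Im (Ln (1 - of_real r * w)))) \<partial>uniform_circle)
      = (\<integral>w. (\<Sum>n. a n * w ^ n) * (\<Sum>n. b n * cnj w ^ n) \<partial>uniform_circle)"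
  proof (rule integral_cong_AE)
    show "AE w in uniform_circle. iexp (t * (- Im (Ln (1 - of_real r * w))))
            = (\<Sum>n. a n * w ^ n) * (\<Sum>n. b n * cnj w ^ n)"
      using AE_uniform_circle_in_disc[OF r]
    proof eventually_elim
      case (elim w)
      define u where "u = 1 - of_real r * w"
      have u: "u \<notin> \<real>\<^sub>\<le>\<^sub>0" "u \<noteq> 0" using elim by (auto simp: u_def)
      have cnj_u: "cnj u \<noteq> 0" using u(2) by (simp only: complex_cnj_zero_iff simp_thms)
      have "(\<lambda>n. a n * w ^ n) sums (u powr (- x))"
        using gen_binomial_complex[of "- (of_real r * w)" "- x"] elim r
        by (simp add: a_def u_def power_mult_distrib[symmetric] mult.assoc)
      moreover have "(\<lambda>n. b n * cnj w ^ n) sums (cnj u powr x)"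
        using gen_binomial_complex[of "- (of_real r * cnj w)" x] elim r
        by (simp add: b_def u_def power_mult_distrib[symmetric] mult.assoc norm_mult)
      moreover have "iexp (t * (- Im (Ln u))) = u powr (- x) * cnj u powr x"
      proof -
        \<comment> \<open>Off the branch cut \<open>Ln (cnj u) = cnj (Ln u)\<close>, so the two
          powers merge into one exponential with purely imaginary exponent.\<close>
        have "u powr (- x) * cnj u powr x = exp (x * (cnj (Ln u) - Ln u))"
          using u cnj_u by (simp add: powr_def cnj_Ln exp_add[symmetric] algebra_simps)
        also have "cnj (Ln u) - Ln u = - 2 * \<i> * of_real (Im (Ln u))"
          by (simp add: complex_eq_iff)
        finally show ?thesis by (simp add: x_def mult_ac)
      qed
      ultimately show ?case by (simp add: sums_iff u_def)
    qed
  qed measurable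
  ultimately show ?thesis
    unfolding euler_factor_eq_suminf[OF p \<sigma>] by (simp add: sums_iff r_def x_def)
qed

theorem theorem1:
  fixes M :: "'a measure" and z :: "nat \<Rightarrow> 'a \<Rightarrow> complex" and \<sigma> :: real
  assumes "prob_space M"
    and "prob_space.indep_vars M (\<lambda>_. borel) z {p. prime p}"
    and "\<And>p. prime p \<Longrightarrow> distr M borel (z p) = uniform_circle"
    and "\<sigma> > 1 / 2"
  shows "\<exists>\<Psi> :: complex \<Rightarrow> complex.
           \<Psi> holomorphic_on UNIV
         \<and> (\<forall>x::real. \<Psi> (of_real x) = psi M z \<sigma> x)
         \<and> (\<forall>x. (\<forall>p. prime p \<longrightarrow> summable (\<lambda>n. factor_term \<sigma> p x (Suc n)))
              \<and> (\<lambda>p. if prime p then euler_factor \<sigma> p x else 1) has_prod \<Psi> (2 * x))"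
proof -
  interpret prob_space M by fact
  note \<sigma> = \<open>\<sigma> > 1 / 2\<close> and ind = assms(2) and unif = assms(3)
  define r where "r p = real p powr - \<sigma>" for p :: nat
  define L where "L p \<omega> = Ln (1 - of_real (r p) * z p \<omega>)" for p \<omega>
  have r: "0 < r p" "r p \<le> 3 / 4" "(r p)\<^sup>2 = real p powr (-2 * \<sigma>)" if "prime p" for p
    using prime_powr_less_one[OF that \<sigma>] by (auto simp: r_def)
  have [measurable]: "z p \<in> borel_measurable M" if "p \<in> {p. prime p}" for p
    using ind that by (auto simp: indep_vars_def)
  have zm: "z p \<in> borel_measurable M" if "prime p" for p using that by simp
  have Lm [measurable]: "L p \<in> borel_measurable M" if "p \<in> {p. prime p}" for p
    unfolding L_def using that by measurable
  have transfer: "(\<integral>\<omega>. f (z p \<omega>) \<partial>M) = (\<integral>w. f w \<partial>uniform_circle)"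
    if "prime p" "f \<in> borel_measurable borel" for p and f :: "complex \<Rightarrow> complex"
    using that by (subst unif[OF that(1), symmetric]) (auto simp: integral_distr)
  have L_bound: "AE \<omega> in M. norm (L p \<omega>) \<le> 4 * r p" if "prime p" for p
  proof -
    have "AE \<omega> in M. norm (z p \<omega>) = 1"
      using AE_distrD[OF zm[OF that], of "\<lambda>w. norm w = 1", unfolded unif[OF that], OF AE_uniform_circle_norm] .
    then show ?thesis
    proof eventually_elim
      case (elim \<omega>)
      then show ?case
        using Ln_one_minus_bound[of "of_real (r p) * z p \<omega>"] r[OF that] by (simp add: L_def norm_mult)
    qed
  qed
  have L_mean: "expectation (L p) = 0" if "prime p" for p
    unfolding L_def using r[OF that]
    by (subst transfer[OF that]) (auto intro!: integral_uniform_circle_Ln)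
  have L_int: "integrable M (L p)" if "prime p" for p
    by (rule integrable_const_bound[OF L_bound[OF that]]) (use that in simp)

  \<comment> \<open>Kolmogorov's theorem concerns real variables, so it is applied through a
    real-linear functional \<open>f\<close>, later \<open>Re\<close> and \<open>Im\<close>.\<close>
  have series: "AE \<omega> in M. summable (\<lambda>p. if p \<in> {p. prime p} then f (L p \<omega>) else 0)"
    if f: "bounded_linear f" and fle: "\<And>w. \<bar>f w\<bar> \<le> norm w" for f :: "complex \<Rightarrow> real"
  proof (rule kolmogorov_one_series)
    have [measurable]: "f \<in> borel_measurable borel"
      using f by (intro borel_measurable_continuous_onI linear_continuous_on)
    show "indep_vars (\<lambda>_. borel) (\<lambda>p \<omega>. f (L p \<omega>)) {p. prime p}"
      unfolding L_def by (rule indep_vars_compose2[OF ind]) measurable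
    \<comment> \<open>The constant 16 is the square of the 4 in the bound on the logarithm; the
      second moments are thus dominated by a convergent series.\<close>
    have bd: "AE \<omega> in M. norm ((f (L p \<omega>))\<^sup>2) \<le> 16 * real p powr (-2 * \<sigma>)" if "prime p" for p
      using L_bound[OF that]
    proof eventually_elim
      case (elim \<omega>)
      then have "\<bar>f (L p \<omega>)\<bar>\<^sup>2 \<le> (4 * r p)\<^sup>2" using fle[of "L p \<omega>"] by (intro power_mono) auto
      then show ?case using r(3)[OF that] by (simp add: power_mult_distrib)
    qed
    have sq: "integrable M (\<lambda>\<omega>. (f (L p \<omega>))\<^sup>2)" if "prime p" for p
      by (rule integrable_const_bound[OF bd[OF that]]) (use that in simp)
    then show "integrable M (\<lambda>\<omega>. (f (L p \<omega>))\<^sup>2)" if "p \<in> {p. prime p}" for p using that by simp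
    show "expectation (\<lambda>\<omega>. f (L p \<omega>)) = 0" if "p \<in> {p. prime p}" for p
      using that integral_bounded_linear[OF f L_int, of p] L_mean[of p]
        linear_0[OF bounded_linear.linear[OF f]] by simp
    show "summable (\<lambda>p. if p \<in> {p. prime p} then expectation (\<lambda>\<omega>. (f (L p \<omega>))\<^sup>2) else 0)"
    proof (rule summable_comparison_test)
      have "expectation (\<lambda>\<omega>. (f (L p \<omega>))\<^sup>2) \<le> 16 * real p powr (-2 * \<sigma>)" if "prime p" for p
      proof -
        have "expectation (\<lambda>\<omega>. (f (L p \<omega>))\<^sup>2) \<le> expectation (\<lambda>\<omega>. 16 * real p powr (-2 * \<sigma>))"
          by (rule integral_mono_AE[OF sq[OF that]]) (use bd[OF that] in auto)
        then show ?thesis by (simp add: prob_space)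
      qed
      then show "\<exists>N. \<forall>p\<ge>N. norm (if p \<in> {p. prime p} then expectation (\<lambda>\<omega>. (f (L p \<omega>))\<^sup>2) else 0)
                   \<le> 16 * real p powr (-2 * \<sigma>)"
        by auto
      show "summable (\<lambda>p. 16 * real p powr (-2 * \<sigma>))"
        using \<sigma> by (intro summable_mult) (simp add: summable_real_powr_iff)
    qed
  qed
  \<comment> \<open>\<open>prime_log_sum\<close> is a complex \<open>suminf\<close>: convergence of
    both parts ensures that its imaginary part is the limit of the imaginary partial sums.\<close>
  have "AE \<omega> in M. summable (\<lambda>p. if prime p then L p \<omega> else 0)"
    using series[OF bounded_linear_Re abs_Re_le_cmod] series[OF bounded_linear_Im abs_Im_le_cmod]
    by eventually_elim (simp add: summable_complex_iff if_distrib cong: if_cong)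
  then have conv: "AE \<omega> in M. (\<lambda>n. \<Sum>p\<in>{p. p < n \<and> prime p}. - Im (L p \<omega>)) \<longlonglongrightarrow> Im (prime_log_sum z \<sigma> \<omega>)"
  proof eventually_elim
    case (elim \<omega>)
    have "(\<Sum>p\<in>{p. p < n \<and> prime p}. - Im (L p \<omega>)) = Im (- (\<Sum>p<n. if prime p then L p \<omega> else 0))" for n
      by (simp add: sum.If_cases if_distrib[of Im] sum_negf Int_def conj_commute)
    moreover have "(\<lambda>n. Im (- (\<Sum>p<n. if prime p then L p \<omega> else 0))) \<longlonglongrightarrow> Im (- (\<Sum>p. if prime p then L p \<omega> else 0))"
      by (intro tendsto_Im tendsto_minus summable_LIMSEQ elim)
    ultimately show ?case unfolding prime_log_sum_def L_def r_def by simp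
  qed
  have Im_S [measurable]: "(\<lambda>\<omega>. Im (prime_log_sum z \<sigma> \<omega>)) \<in> borel_measurable M"
  proof -
    have "(\<lambda>\<omega>. if prime p then Ln (1 - of_real (real p powr - \<sigma>) * z p \<omega>) else 0) \<in> borel_measurable M" for p
      by (cases "prime p") auto
    then show ?thesis unfolding prime_log_sum_def by measurable
  qed

  \<comment> \<open>Dividing the argument by 2 makes the value at \<open>2 * x\<close> the Euler
    product at \<open>x\<close>.\<close>
  define \<Psi> where "\<Psi> y = (\<Prod>p. if prime p then euler_factor \<sigma> p (y / 2) else 1)" for y
  have has_prod: "(\<lambda>p. if prime p then euler_factor \<sigma> p x else 1) has_prod \<Psi> (2 * x)" for x
    using euler_product_has_prod[OF \<sigma>, of x] by (simp add: \<Psi>_def cong: if_cong)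
  have "(\<lambda>y::complex. y / 2) holomorphic_on UNIV" by (intro holomorphic_intros) auto
  from holomorphic_on_compose_gen[OF this euler_product_holomorphic[OF \<sigma>]]
  have "\<Psi> holomorphic_on UNIV" by (simp add: comp_def \<Psi>_def[abs_def])
  moreover have "\<Psi> (of_real t) = psi M z \<sigma> t" for t
  proof -
    \<comment> \<open>By independence the characteristic function of a partial sum is a finite
      product, and each of its factors is an integral over the circle.\<close>
    have "char (distr M borel (\<lambda>\<omega>. \<Sum>p\<in>{p. p < n \<and> prime p}. - Im (L p \<omega>))) t
        = (\<Prod>p<n. if prime p then euler_factor \<sigma> p (of_real t / 2) else 1)" for n
    proof -
      have "indep_vars (\<lambda>_. borel) (\<lambda>p \<omega>. - Im (L p \<omega>)) {p. prime p}"
        unfolding L_def by (rule indep_vars_compose2[OF ind]) measurable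
      then have "indep_vars (\<lambda>_. borel) (\<lambda>p \<omega>. - Im (L p \<omega>)) {p. p < n \<and> prime p}"
        by (rule indep_vars_subset) auto
      then have "char (distr M borel (\<lambda>\<omega>. \<Sum>p\<in>{p. p < n \<and> prime p}. - Im (L p \<omega>))) t
          = (\<Prod>p\<in>{p. p < n \<and> prime p}. char (distr M borel (\<lambda>\<omega>. - Im (L p \<omega>))) t)"
        by (rule char_distr_sum)
      also have "\<dots> = (\<Prod>p\<in>{p. p < n \<and> prime p}. euler_factor \<sigma> p (of_real t / 2))"
      proof (rule prod.cong[OF refl])
        fix p assume "p \<in> {p. p < n \<and> prime p}"
        then have p: "prime p" by simp
        have "char (distr M borel (\<lambda>\<omega>. - Im (L p \<omega>))) t = (\<integral>\<omega>. iexp (t * (- Im (L p \<omega>))) \<partial>M)"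
          unfolding char_def using p by (subst integral_distr) auto
        also have "\<dots> = (\<integral>w. iexp (t * (- Im (Ln (1 - of_real (r p) * w)))) \<partial>uniform_circle)"
          unfolding L_def by (rule transfer[OF p]) measurable
        also have "\<dots> = euler_factor \<sigma> p (of_real t / 2)"
          unfolding r_def by (rule integral_uniform_circle_euler_factor[OF p \<sigma>])
        finally show "char (distr M borel (\<lambda>\<omega>. - Im (L p \<omega>))) t = euler_factor \<sigma> p (of_real t / 2)" .
      qed
      also have "\<dots> = (\<Prod>p<n. if prime p then euler_factor \<sigma> p (of_real t / 2) else 1)"
        by (simp add: prod.If_cases Int_def)
      finally show ?thesis .
    qed
    then have "(\<lambda>n. char (distr M borel (\<lambda>\<omega>. \<Sum>p\<in>{p. p < n \<and> prime p}. - Im (L p \<omega>))) t) \<longlonglongrightarrow> \<Psi> (of_real t)"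
      using has_prod_imp_tendsto'[OF has_prod[of "of_real t / 2"]] by simp
    \<comment> \<open>The same sequence has a second limit: the exponentials converge almost surely
      and are dominated by the constant 1.\<close>
    moreover have "(\<lambda>n. char (distr M borel (\<lambda>\<omega>. \<Sum>p\<in>{p. p < n \<and> prime p}. - Im (L p \<omega>))) t) \<longlonglongrightarrow> psi M z \<sigma> t"
    proof -
      have [measurable]: "(\<lambda>\<omega>. \<Sum>p\<in>{p. p < n \<and> prime p}. - Im (L p \<omega>)) \<in> borel_measurable M" for n
        by (intro borel_measurable_sum) auto
      have "(\<lambda>n. \<integral>\<omega>. iexp (t * (\<Sum>p\<in>{p. p < n \<and> prime p}. - Im (L p \<omega>))) \<partial>M)
              \<longlonglongrightarrow> (\<integral>\<omega>. iexp (t * Im (prime_log_sum z \<sigma> \<omega>)) \<partial>M)"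
      proof (rule integral_dominated_convergence)
        show "AE \<omega> in M. (\<lambda>n. iexp (t * (\<Sum>p\<in>{p. p < n \<and> prime p}. - Im (L p \<omega>))))
                \<longlonglongrightarrow> iexp (t * Im (prime_log_sum z \<sigma> \<omega>))"
          using conv by eventually_elim (intro tendsto_intros)
        show "AE \<omega> in M. norm (iexp (t * (\<Sum>p\<in>{p. p < n \<and> prime p}. - Im (L p \<omega>)))) \<le> 1" for n by simp
      qed auto
      then show ?thesis unfolding psi_def char_def by (simp add: integral_distr)
    qed
    ultimately show ?thesis using LIMSEQ_unique by blast
  qed
  ultimately show ?thesis
    using has_prod summable_factor_term[OF _ \<sigma>] by blast
qed

end
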